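(* Let $\mathcal{H}_A$ be a finite-dimensional complex Hilbert space with a fixed orthonormal basis $\{|j\rangle\}$, and let $\mathcal{H}_{A'}$, $\mathcal{H}_{A''}$ be copies of $\mathcal{H}_A$. Suppose that $\mathcal{E}_{A'A''|A}:\mathfrak{L}(\mathcal{H}_A)\to\mathfrak{L}(\mathcal{H}_{A'}\otimes\mathcal{H}_{A''})$ is a cloning map for an ensemble of at least two pairwise nonorthogonal and nonidentical pure states $\{(p_k,|\psi_k\rangle)\}_k$ on $\mathcal{H}_A$, where $0<p_k<1$ and $\sum_k p_k=1$. Let $\rho_A=\sum_k p_k|\psi_k\rangle\langle\psi_k|$ and let $\tau_{AA'A''}$ be the tripartite state isomorphic to $(\rho_A,\mathcal{E}^r_{A'A''|A})$. Then both reduced states $\tau_{AA'}=\mathrm{Tr}_{A''}(\tau_{AA'A''})$ and $\tau_{AA''}=\mathrm{Tr}_{A'}(\tau_{AA'A''})$ are pure and entangled.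
   Context: $\mathfrak{L}(\mathcal{H})$ is the space of linear operators on $\mathcal{H}$. A trace-preserving completely positive map $\mathcal{E}_{A'A''|A}$ is cloning for a density operator $\rho$ on $\mathcal{H}_A$ if $\mathcal{E}_{A'A''|A}(\rho)=\rho\otimes\rho$ (identifying the three copies of the Hilbert space); a cloning map for an ensemble $\{(p_k,|\psi_k\rangle)\}_k$ is a trace-preserving completely positive map that is cloning for every $|\psi_k\rangle\langle\psi_k|$. Unit vectors $|\psi\rangle,|\phi\rangle$ represent nonorthogonal and nonidentical pure states when $0<|\langle\psi|\phi\rangle|<1$. Isomorphic state: for a density operator $\rho_A$ on $\mathcal{H}_A$ and a trace-preserving completely positive map $\mathcal{E}_{B|A}:\mathfrak{L}(\mathcal{H}_A)\to\mathfrak{L}(\mathcal{H}_B)$ (here $B$ is the composite system $A'A''$), with $\mathcal{E}^r_{B|A}$ the restriction of $\mathcal{E}_{B|A}$ to operators supported on the support of $\rho_A$, the state isomorphic to $(\rho_A,\mathcal{E}^r_{B|A})$ is $\tau_{AB}=(\mathcal{I}_A\otimes\mathcal{E}^r_{B|C})(|\Phi\rangle\langle\Phi|_{AC})$, where $C$ is an auxiliary copy of $A$, $\mathcal{I}_A$ is the identity map on $\mathfrak{L}(\mathcal{H}_A)$, $\mathcal{E}^r_{B|C}$ is $\mathcal{E}^r_{B|A}$ applied to $C$, and $|\Phi\rangle_{AC}=((\rho_A^T)^{1/2}\otimes I_C)\sum_j|j\rangle_A\otimes|j\rangle_C$, with $^T$ the transpose in the basis $\{|j\rangle\}$. A pure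 bipartite state is entangled if it is not a product state, i.e. its Schmidt rank is at least 2. *)

theory Defs
  imports "HOL-Analysis.Analysis"
begin

text \<open>
  A finite-dimensional Hilbert space with a fixed orthonormal basis indexed by the finite type
  \<open>'a\<close> is \<open>complex^'a\<close>, with \<open>axis j 1\<close> as basis vectors. Operators are their matrices
  \<open>complex^'a^'a\<close> in this basis, and the tensor product of two spaces is indexed by the
  product type \<open>'a \<times> 'b\<close>.
\<close>

definition cscale :: "complex \<Rightarrow> complex^'a^'b \<Rightarrow> complex^'a^'b" where
  "cscale c X = (\<chi> i j. c * X $ i $ j)"

text \<open>Complex inner product, conjugate-linear in the first argument.\<close>

definition cinner :: "complex^'a \<Rightarrow> complex^'a \<Rightarrow> complex" where
  "cinner v w = (\<Sum>i\<in>UNIV. cnj (v $ i) * w $ i)"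

definition psd :: "complex^'a^'a \<Rightarrow> bool" where
  "psd M \<longleftrightarrow> (\<forall>v. cinner v (M *v v) \<in> \<real>\<^sub>\<ge>\<^sub>0)"

text \<open>The unique positive semidefinite square root; only meaningful if \<open>psd M\<close>.\<close>

definition psd_sqrt :: "complex^'a^'a \<Rightarrow> complex^'a^'a" where
  "psd_sqrt M = (THE S. psd S \<and> S ** S = M)"

definition ketbra :: "complex^'a \<Rightarrow> complex^'a^'a" where
  "ketbra v = (\<chi> i j. v $ i * cnj (v $ j))"

definition kron_vec :: "complex^'a \<Rightarrow> complex^'b \<Rightarrow> complex^('a::finite \<times> 'b::finite)" where
  "kron_vec v w = (\<chi> x. v $ fst x * w $ snd x)"

definition kron_mat ::
    "complex^'a^'a \<Rightarrow> complex^'b^'b \<Rightarrow> complex^('a::finite \<times> 'b::finite)^('a \<times> 'b)" where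
  "kron_mat M N = (\<chi> x y. M $ fst x $ fst y * N $ snd x $ snd y)"

text \<open>
  An operator \<open>M\<close> on a product space decomposes as the sum over \<open>a, a'\<close> of
  \<open>|a\<rangle>\<langle>a'| \<otimes> block M a a'\<close>.
\<close>

definition block :: "complex^('a::finite \<times> 'b::finite)^('a \<times> 'b) \<Rightarrow> 'a \<Rightarrow> 'a \<Rightarrow> complex^'b^'b" where
  "block M a a' = (\<chi> c d. M $ (a, c) $ (a', d))"

text \<open>The map \<open>\<I> \<otimes> F\<close>, acting as \<open>F\<close> on each block.\<close>

definition id_tensor ::
    "(complex^'b^'b \<Rightarrow> complex^'c^'c) \<Rightarrow>
     complex^('a::finite \<times> 'b::finite)^('a \<times> 'b) \<Rightarrow> complex^('a \<times> 'c::finite)^('a \<times> 'c)" where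
  "id_tensor F M = (\<chi> x y. F (block M (fst x) (fst y)) $ snd x $ snd y)"

text \<open>
  Since the ancilla dimension in complete positivity ranges over all natural numbers, an operator
  on the tensor product of \<open>k\<close>-dimensional space with \<open>complex^'a\<close> is given here by its
  \<open>k \<times> k\<close> array of blocks \<open>X i j\<close>; a vector in that space is a tuple \<open>v 0, \<dots>, v (k - 1)\<close>.
  Applying \<open>\<I> \<otimes> E\<close> amounts to applying \<open>E\<close> to every block.
\<close>

definition block_psd :: "nat \<Rightarrow> (nat \<Rightarrow> nat \<Rightarrow> complex^'a^'a) \<Rightarrow> bool" where
  "block_psd k X \<longleftrightarrow>
     (\<forall>v :: nat \<Rightarrow> complex^'a. (\<Sum>i<k. \<Sum>j<k. cinner (v i) (X i j *v v j)) \<in> \<real>\<^sub>\<ge>\<^sub>0)"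

definition completely_positive :: "(complex^'a^'a \<Rightarrow> complex^'b^'b) \<Rightarrow> bool" where
  "completely_positive E \<longleftrightarrow>
     Vector_Spaces.linear cscale cscale E \<and>
     (\<forall>k X. block_psd k X \<longrightarrow> block_psd k (\<lambda>i j. E (X i j)))"

definition trace_preserving :: "(complex^'a^'a \<Rightarrow> complex^'b^'b) \<Rightarrow> bool" where
  "trace_preserving E \<longleftrightarrow> (\<forall>X. trace (E X) = trace X)"

definition tpcp :: "(complex^'a^'a \<Rightarrow> complex^'b^'b) \<Rightarrow> bool" where
  "tpcp E \<longleftrightarrow> completely_positive E \<and> trace_preserving E"

definition cloning_for ::
    "(complex^'a^'a \<Rightarrow> complex^('a::finite \<times> 'a)^('a \<times> 'a)) \<Rightarrow> complex^'a^'a \<Rightarrow> bool" where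
  "cloning_for E \<rho> \<longleftrightarrow> E \<rho> = kron_mat \<rho> \<rho>"

text \<open>The weights of the ensemble play no role in this notion.\<close>

definition cloning_map_for_ensemble ::
    "(complex^'a^'a \<Rightarrow> complex^('a::finite \<times> 'a)^('a \<times> 'a)) \<Rightarrow> 'k set \<Rightarrow> ('k \<Rightarrow> complex^'a) \<Rightarrow> bool" where
  "cloning_map_for_ensemble E K \<psi> \<longleftrightarrow> tpcp E \<and> (\<forall>k\<in>K. cloning_for E (ketbra (\<psi> k)))"

text \<open>
  The index set may be finite or countably infinite; on a finite set the unconditional sum is the
  ordinary one.
\<close>

definition ensemble_state :: "'k set \<Rightarrow> ('k \<Rightarrow> real) \<Rightarrow> ('k \<Rightarrow> complex^'a) \<Rightarrow> complex^'a^'a" where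
  "ensemble_state K p \<psi> = (\<Sum>\<^sub>\<infinity>k\<in>K. cscale (of_real (p k)) (ketbra (\<psi> k)))"

text \<open>The orthogonal complement of the kernel.\<close>

definition support :: "complex^'a^'a \<Rightarrow> (complex^'a) set" where
  "support \<rho> = {v. \<forall>w. \<rho> *v w = 0 \<longrightarrow> cinner w v = 0}"

text \<open>Operators mapping into the subspace \<open>S\<close> and vanishing on its orthogonal complement.\<close>

definition operators_on :: "(complex^'a) set \<Rightarrow> (complex^'a^'a) set" where
  "operators_on S =
     {X. (\<forall>v. X *v v \<in> S) \<and> (\<forall>w. (\<forall>v\<in>S. cinner v w = 0) \<longrightarrow> X *v w = 0)}"

definition restricted_map ::
    "complex^'a^'a \<Rightarrow> (complex^'a^'a \<Rightarrow> complex^'b^'b) \<Rightarrow> (complex^'a^'a \<Rightarrow> complex^'b^'b)" where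
  "restricted_map \<rho> E = restrict E (operators_on (support \<rho>))"

definition Phi :: "complex^'a^'a \<Rightarrow> complex^('a::finite \<times> 'a)" where
  "Phi \<rho> =
     kron_mat (psd_sqrt (transpose \<rho>)) (mat 1) *v (\<Sum>j\<in>UNIV. kron_vec (axis j 1) (axis j 1))"

text \<open>
  The map \<open>F\<close> need only be specified on operators supported on the support of \<open>\<rho>\<close>: the blocks of
  \<open>ketbra (Phi \<rho>)\<close> are the operators \<open>|r\<^sub>a\<rangle>\<langle>r\<^sub>b|\<close>, where \<open>r\<^sub>a\<close> is column \<open>a\<close> of the square root of
  \<open>\<rho>\<close>, and such columns lie in that support.
\<close>

definition isomorphic_state ::
    "complex^'a^'a \<Rightarrow> (complex^'a^'a \<Rightarrow> complex^'b^'b) \<Rightarrow>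
     complex^('a::finite \<times> 'b::finite)^('a \<times> 'b)" where
  "isomorphic_state \<rho> F = id_tensor F (ketbra (Phi \<rho>))"

text \<open>Partial traces over the third and over the second factor of a tripartite system.\<close>

definition trace_third ::
    "complex^('a::finite \<times> 'b::finite \<times> 'c::finite)^('a \<times> 'b \<times> 'c) \<Rightarrow> complex^('a \<times> 'b)^('a \<times> 'b)" where
  "trace_third M =
     (\<chi> x y. \<Sum>c\<in>UNIV. M $ (fst x, snd x, c) $ (fst y, snd y, c))"

definition trace_second ::
    "complex^('a::finite \<times> 'b::finite \<times> 'c::finite)^('a \<times> 'b \<times> 'c) \<Rightarrow> complex^('a \<times> 'c)^('a \<times> 'c)" where
  "trace_second M =
     (\<chi> x y. \<Sum>b\<in>UNIV. M $ (fst x, b, snd x) $ (fst y, b, snd y))"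

definition product_vec :: "complex^('a::finite \<times> 'b::finite) \<Rightarrow> bool" where
  "product_vec v \<longleftrightarrow> (\<exists>x y. v = kron_vec x y)"

text \<open>The vector representing a pure state is unique up to a phase, which does not affect
  being a product.\<close>

definition pure_entangled :: "complex^('a::finite \<times> 'b::finite)^('a \<times> 'b) \<Rightarrow> bool" where
  "pure_entangled M \<longleftrightarrow> (\<exists>v. norm v = 1 \<and> M = ketbra v \<and> \<not> product_vec v)"

end

theory Submission
  imports Defs
begin

text \<open>
  Two distinct nonorthogonal pure states cannot be cloned, so the hypotheses are contradictory and
  the claim holds vacuously. For unit vectors \<open>a, b\<close>, the block operator with entries
  \<open>|a\<rangle>\<langle>a|\<close>, \<open>|a\<rangle>\<langle>b|\<close>, \<open>|b\<rangle>\<langle>a|\<close>, \<open>|b\<rangle>\<langle>b|\<close> is positive, hence so is its image under a cloning map.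
  The diagonal blocks of the image have rank one, which forces the image of \<open>|a\<rangle>\<langle>b|\<close> to be
  \<open>z |aa\<rangle>\<langle>bb|\<close> with \<open>|z| \<le> 1\<close>. Comparing traces gives \<open>|\<langle>b|a\<rangle>| \<le> |\<langle>b|a\<rangle>|\<^sup>2\<close>, so the overlap
  has modulus 0 or at least 1.
\<close>

text \<open>The dyad |v><w|. \<open>ketbra\<close> covers only v = w, while the proof turns on the
  image of an off-diagonal dyad.\<close>

definition outer :: "complex^'a \<Rightarrow> complex^'b \<Rightarrow> complex^'b^'a" where
  "outer v w = (\<chi> i j. v $ i * cnj (w $ j))"

lemma outer_self: "outer v v = ketbra v"
  by (simp add: outer_def ketbra_def)

lemma cinner_diff_left: "cinner (u - v) w = cinner u w - cinner v w"
  by (simp add: cinner_def algebra_simps sum_subtractf)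

lemma cinner_diff_right: "cinner w (u - v) = cinner w u - cinner w v"
  by (simp add: cinner_def algebra_simps sum_subtractf)

lemma cinner_scale_left: "cinner (c *s v) w = cnj c * cinner v w"
  by (simp add: cinner_def algebra_simps sum_distrib_left)

lemma cinner_scale_right: "cinner v (c *s w) = c * cinner v w"
  by (simp add: cinner_def algebra_simps sum_distrib_left)

lemma cnj_cinner: "cnj (cinner v w) = cinner w v"
  by (simp add: cinner_def mult.commute)

lemma cinner_self: "cinner v v = complex_of_real ((norm v)\<^sup>2)"
proof -
  have "(norm v)\<^sup>2 = (\<Sum>i\<in>UNIV. (cmod (v $ i))\<^sup>2)"
    by (simp add: norm_vec_def L2_set_def sum_nonneg)
  then show ?thesis
    by (simp only: cinner_def of_real_sum complex_norm_square mult.commute)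
qed

lemma outer_mult_vec: "outer a b *v w = cinner b w *s a"
  by (simp add: vec_eq_iff outer_def matrix_vector_mult_def cinner_def sum_distrib_left
      sum_distrib_right mult_ac)

lemma cinner_ketbra: "cinner v (ketbra a *v v) = complex_of_real ((cmod (cinner v a))\<^sup>2)"
proof -
  have "cinner v (ketbra a *v v) = cinner v a * cnj (cinner v a)"
    by (simp add: outer_self[symmetric] outer_mult_vec cinner_scale_right cnj_cinner)
  then show ?thesis
    by (simp only: complex_norm_square)
qed

lemma trace_outer: "trace (outer a b) = cinner b a"
  by (simp add: trace_def outer_def cinner_def mult.commute)

lemma cinner_axis: "cinner (axis i 1) v = v $ i"
proof -
  have "cnj (axis i 1 $ j) * v $ j = (if j = i then v $ i else 0)" for j
    by (simp add: axis_def)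
  then show ?thesis
    by (simp add: cinner_def)
qed

lemma cinner_kron_vec: "cinner (kron_vec a b) (kron_vec c d) = cinner a c * cinner b d"
  unfolding cinner_def kron_vec_def sum_product UNIV_Times_UNIV[symmetric] sum.cartesian_product
  by (intro sum.cong) (auto simp: mult_ac)

lemma kron_mat_ketbra: "kron_mat (ketbra a) (ketbra b) = ketbra (kron_vec a b)"
  by (simp add: vec_eq_iff kron_mat_def ketbra_def kron_vec_def mult_ac)

text \<open>These blocks form the rank-one operator of the tuple \<open>f\<close>, so the quadratic
  form factors as s * cnj s.\<close>

lemma block_psd_outer: "block_psd k (\<lambda>i j. outer (f i) (f j))"
  unfolding block_psd_def
proof
  fix v :: "nat \<Rightarrow> complex^'a"
  define s where "s = (\<Sum>i<k. cinner (v i) (f i))"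
  have "(\<Sum>i<k. \<Sum>j<k. cinner (v i) (outer (f i) (f j) *v v j)) = s * cnj s"
    unfolding s_def cnj_sum sum_product
    by (intro sum.cong refl) (simp add: outer_mult_vec cinner_scale_right cnj_cinner)
  then show "(\<Sum>i<k. \<Sum>j<k. cinner (v i) (outer (f i) (f j) *v v j)) \<in> \<real>\<^sub>\<ge>\<^sub>0"
    by (simp only: complex_norm_square[symmetric] nonneg_Reals_of_real_iff) simp
qed

text \<open>A determinant condition: the 2 x 2 matrix with diagonal A, B and off-diagonal \<alpha>,
  \<beta> is tested only on the vectors (s, 1).\<close>

lemma sesquilinear_nonneg_bound:
  fixes \<alpha> \<beta> :: complex and A B :: real
  assumes nonneg: "\<And>s. of_real ((cmod s)\<^sup>2 * A) + cnj s * \<alpha> + s * \<beta> + of_real B \<in> \<real>\<^sub>\<ge>\<^sub>0"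
    and A: "0 \<le> A"
  shows "(cmod \<alpha>)\<^sup>2 \<le> A * B"
proof -
  \<comment> \<open>Vanishing of the imaginary part at s = 1 gives the first equation, at s =
    \<open>\<i>\<close> the second; together they say that the form is Hermitian.\<close>
  have "Im \<alpha> + Im \<beta> = 0" "Re \<beta> = Re \<alpha>"
    using nonneg[of 1] nonneg[of \<i>] by (auto simp: complex_nonneg_Reals_iff)
  then have \<beta>: "\<beta> = cnj \<alpha>"
    by (simp add: complex_eq_iff)
  define N where "N = (cmod \<alpha>)\<^sup>2"
  have N: "N = (Re \<alpha>)\<^sup>2 + (Im \<alpha>)\<^sup>2"
    by (simp add: N_def cmod_power2)
  have quad: "0 \<le> t\<^sup>2 * N * A - 2 * t * N + B" for t :: real
  proof -
    \<comment> \<open>This phase makes both cross terms real, each equal to -t * N.\<close>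
    let ?s = "- of_real t * \<alpha>"
    have "(cmod ?s)\<^sup>2 = t\<^sup>2 * N"
      by (simp add: N_def norm_mult power_mult_distrib)
    then have "0 \<le> t\<^sup>2 * N * A + Re (cnj ?s * \<alpha> + ?s * cnj \<alpha>) + B"
      using nonneg[of ?s] by (simp add: \<beta> complex_nonneg_Reals_iff)
    moreover have "Re (cnj ?s * \<alpha> + ?s * cnj \<alpha>) = - 2 * t * N"
      by (simp add: N algebra_simps power2_eq_square)
    ultimately show ?thesis
      by simp
  qed
  have "N \<le> A * B"
  proof (cases "A = 0")
    case True
    have "N = 0"
    proof (rule ccontr)
      assume "N \<noteq> 0"
      \<comment> \<open>With A = 0 the quadratic is linear in t, and this t gives it the value
        -1.\<close>
      then show False
        using quad[of "(B + 1) / (2 * N)"] True by simp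
    qed
    then show ?thesis
      using True by simp
  next
    case False
    then have "(1 / A)\<^sup>2 * N * A = N / A"
      by (simp add: power2_eq_square)
    \<comment> \<open>t = 1 / A minimises the quadratic.\<close>
    then have "N / A \<le> B"
      using quad[of "1 / A"] by simp
    then show ?thesis
      using A False by (simp add: field_simps)
  qed
  then show ?thesis
    by (simp add: N_def)
qed

lemma matrix_vector_mult_scale: "(M :: complex^'a^'b) *v (c *s v) = c *s (M *v v)"
  by (simp add: vec_eq_iff matrix_vector_mult_def sum_distrib_left mult_ac)

text \<open>Complete positivity with a two-dimensional ancilla, tested on the tuple (s v, w), yields
  the form of \<open>sesquilinear_nonneg_bound\<close>. The known images of the diagonal blocks
  supply A and B.\<close>

lemma completely_positive_outer_bound:
  assumes cp: "completely_positive E"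
    and a: "E (ketbra a) = ketbra a'" and b: "E (ketbra b) = ketbra b'"
  shows "cmod (cinner v (E (outer a b) *v w)) \<le> cmod (cinner v a') * cmod (cinner w b')"
proof -
  define f where "f i = (if i = 0 then a else b)" for i :: nat
  have psd: "block_psd 2 (\<lambda>i j. E (outer (f i) (f j)))"
    using cp block_psd_outer[of 2 f] unfolding completely_positive_def by blast
  have "of_real ((cmod s)\<^sup>2 * (cmod (cinner v a'))\<^sup>2) + cnj s * cinner v (E (outer a b) *v w)
      + s * cinner w (E (outer b a) *v v) + of_real ((cmod (cinner w b'))\<^sup>2) \<in> \<real>\<^sub>\<ge>\<^sub>0" for s
  proof -
    let ?u = "\<lambda>i::nat. if i = 0 then s *s v else w"
    have "(\<Sum>i<2. \<Sum>j<2. cinner (?u i) (E (outer (f i) (f j)) *v ?u j)) \<in> \<real>\<^sub>\<ge>\<^sub>0"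
      using psd[unfolded block_psd_def, rule_format, of ?u] .
    moreover have "s * (cnj s * x) = of_real (cmod s) * of_real (cmod s) * x" for x
      using complex_norm_square[of s] by (simp add: power2_eq_square mult.assoc)
    ultimately show ?thesis
      by (simp add: numeral_2_eq_2 f_def outer_self a b cinner_ketbra
          matrix_vector_mult_scale cinner_scale_left cinner_scale_right norm_mult
          power_mult_distrib add_ac)
  qed
  from sesquilinear_nonneg_bound[OF this] show ?thesis
    by (simp add: power_mult_distrib[symmetric] abs_le_square_iff[symmetric])
qed

text \<open>The bound vanishes when v is orthogonal to a' or w to b', so E(|a><b|) = z |a'><b'|; the
  bound at (a', b') gives |z| \<le> 1.\<close>

lemma cmod_trace_outer_le:
  assumes cp: "completely_positive E"
    and a: "E (ketbra a) = ketbra a'" and b: "E (ketbra b) = ketbra b'"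
    and na: "norm a' = 1" and nb: "norm b' = 1"
  shows "cmod (trace (E (outer a b))) \<le> cmod (cinner b' a')"
proof -
  define Y where "Y = E (outer a b)"
  have bound: "cmod (cinner v (Y *v w)) \<le> cmod (cinner v a') * cmod (cinner w b')" for v w
    unfolding Y_def by (rule completely_positive_outer_bound[OF cp a b])
  have unit: "cinner a' a' = 1" "cinner b' b' = 1"
    by (simp_all add: cinner_self na nb)
  \<comment> \<open>The component of v orthogonal to a' contributes nothing; \<open>right\<close>
    does the same for w and b'.\<close>
  have left: "cinner v (Y *v w) = cinner v a' * cinner a' (Y *v w)" for v w
    using bound[of "v - cinner a' v *s a'" w]
    by (simp add: cinner_diff_left cinner_scale_left cnj_cinner unit)
  have right: "cinner v (Y *v w) = cinner b' w * cinner v (Y *v b')" for v w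
    using bound[of v "w - cinner b' w *s b'"]
    by (simp add: cinner_diff_left cinner_diff_right cinner_scale_left cinner_scale_right
        cnj_cinner unit matrix_vector_mult_diff_distrib matrix_vector_mult_scale)
  define z where "z = cinner a' (Y *v b')"
  \<comment> \<open>Diagonal entries suffice for the trace.\<close>
  have "Y $ i $ i = z * outer a' b' $ i $ i" for i
  proof -
    have "Y $ i $ i = cinner (axis i 1) (Y *v axis i 1)"
      unfolding cinner_axis
      by (simp add: matrix_vector_mult_def axis_def if_distrib cong: if_cong)
    also have "\<dots> = a' $ i * (cinner b' (axis i 1) * z)"
      using left[of "axis i 1" "axis i 1"] right[of a' "axis i 1"]
      by (simp add: cinner_axis z_def)
    also have "cinner b' (axis i 1) = cnj (b' $ i)"
      by (metis cnj_cinner cinner_axis)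
    finally show ?thesis
      by (simp add: outer_def)
  qed
  then have "trace Y = z * cinner b' a'"
    by (simp add: trace_outer[symmetric] trace_def sum_distrib_left)
  moreover have "cmod z \<le> 1"
    using bound[of a' b'] by (simp add: z_def unit)
  ultimately show ?thesis
    by (simp add: Y_def norm_mult mult_left_le_one_le)
qed

lemma no_cloning:
  assumes E: "tpcp E"
    and clone: "cloning_for E (ketbra a)" "cloning_for E (ketbra b)"
    and unit: "norm a = 1" "norm b = 1"
  shows "cinner a b = 0 \<or> 1 \<le> cmod (cinner a b)"
proof -
  have norm_kron: "norm (kron_vec v v) = 1" if "norm v = 1" for v :: "complex^'a"
  proof -
    have "complex_of_real ((norm (kron_vec v v))\<^sup>2) = 1"
      unfolding cinner_self[symmetric] cinner_kron_vec by (simp add: cinner_self that)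
    then have "(norm (kron_vec v v))\<^sup>2 = 1"
      by (simp only: of_real_eq_1_iff)
    then show ?thesis
      unfolding power2_eq_1_iff using norm_ge_zero[of "kron_vec v v"] by linarith
  qed
  \<comment> \<open>The order b, a makes the preserved trace equal to \<open>cinner a b\<close>; the
    overlap of the clones is its square.\<close>
  have "cmod (trace (E (outer b a))) \<le> cmod (cinner (kron_vec a a) (kron_vec b b))"
    using E clone unit norm_kron
    by (intro cmod_trace_outer_le) (auto simp: tpcp_def cloning_for_def kron_mat_ketbra)
  then have "cmod (cinner a b) \<le> cmod (cinner a b) * cmod (cinner a b)"
    using E by (simp add: tpcp_def trace_preserving_def trace_outer cinner_kron_vec norm_mult)
  then show ?thesis
    by (auto simp: mult_le_cancel_left1)
qed

theorem theoremV8: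
  fixes E :: "complex^'n^'n \<Rightarrow> complex^('n::finite \<times> 'n)^('n \<times> 'n)"
    and K :: "'k set"
    and p :: "'k \<Rightarrow> real"
    and \<psi> :: "'k \<Rightarrow> complex^'n"
    and \<rho> :: "complex^'n^'n"
    and \<tau> :: "complex^('n \<times> 'n \<times> 'n)^('n \<times> 'n \<times> 'n)"
  assumes at_least_two: "\<exists>i\<in>K. \<exists>j\<in>K. i \<noteq> j"
    and unit: "\<And>k. k \<in> K \<Longrightarrow> norm (\<psi> k) = 1"
    and nonorth_nonid:
      "pairwise (\<lambda>i j. 0 < cmod (cinner (\<psi> i) (\<psi> j)) \<and> cmod (cinner (\<psi> i) (\<psi> j)) < 1) K"
    and weights: "\<And>k. k \<in> K \<Longrightarrow> 0 < p k \<and> p k < 1"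
    and weights_sum: "(p has_sum 1) K"
    and cloning: "cloning_map_for_ensemble E K \<psi>"
    and rho: "\<rho> = ensemble_state K p \<psi>"
    and tau: "\<tau> = isomorphic_state \<rho> (restricted_map \<rho> E)"
  shows "pure_entangled (trace_third \<tau>) \<and> pure_entangled (trace_second \<tau>)"
proof -
  obtain i j where ij: "i \<in> K" "j \<in> K" "i \<noteq> j"
    using at_least_two by blast
  then have "0 < cmod (cinner (\<psi> i) (\<psi> j))" "cmod (cinner (\<psi> i) (\<psi> j)) < 1"
    using nonorth_nonid by (auto simp: pairwise_def)
  \<comment> \<open>Both alternatives contradict the strict bounds on the overlap of this
    pair.\<close>
  moreover have "cinner (\<psi> i) (\<psi> j) = 0 \<or> 1 \<le> cmod (cinner (\<psi> i) (\<psi> j))"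
    using cloning ij unit by (intro no_cloning) (auto simp: cloning_map_for_ensemble_def)
  ultimately show ?thesis
    by auto
qed

end
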